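(* In the power-beacon assisted multi-source network described in the context, with energy states $\vec s_1,\dots,\vec s_N$, $N=(1+L)^K$, and one-step state transition matrix $\mathbf A\in\mathbb R^{N\times N}$, the overall connection outage probability is $$P_{CO}=\sum_{n:\ \vec s_n\in\Theta_2}\pi_n\prod_{k\in\vartheta_n^{TH}}\left(1-\exp\left(-\frac{N_0\,\gamma_{th}^t}{\bar\gamma_{S_kD}\,P_S}\right)\right),$$ where $\gamma_{th}^t=2^{R_t}-1$ and $\pi_n$ is the $n$-th component of $$\boldsymbol\pi=\left(\mathbf A^{T}-\mathbf E+\mathbf Q\right)^{-1}\mathbf b ,$$ with $\mathbf E$ the $N\times N$ identity matrix, $\mathbf Q$ the $N\times N$ all-ones matrix and $\mathbf b=(1,1,\dots,1)^T\in\mathbb R^N$.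
   Context: Network. There are a power beacon $B$ with $N_B\ge 2$ antennas and transmit power $P_B>0$, $K\ge 1$ single-antenna half-duplex sources $S_1,\dots,S_K$, and a single-antenna destination $D$. Time is divided into slots of length $T_0>0$. In each slot the channel coefficients $h_{B_bS_k}$, $h_{B_bD}$ (from antenna $b$ of $B$), $h_{S_kD}$, $h_{S_iS_k}$ are mutually independent circularly symmetric complex Gaussian variables, with $\mathbb E|h_{B_bS_k}|^2=\bar\gamma_{BS_k}$ (for all $b$), $\mathbb E|h_{B_bD}|^2=\bar\gamma_{BD}$, $\mathbb E|h_{S_kD}|^2=\bar\gamma_{S_kD}$, $\mathbb E|h_{S_iS_k}|^2=\bar\gamma_{S_iS_k}$, all positive constants; they are independent from slot to slot. Write $\mathbf h_{BS_k}=[h_{B_1S_k},\dots,h_{B_{N_B}S_k}]^T$, $\mathbf h_{BD}=[h_{B_1D},\dots,h_{B_{N_B}D}]^T$. Energy levels. Each source has an energy storage of capacity $\varepsilon_T>0$, discretized into levels $0,1,\dots,L$ ($L\ge1$), level $l$ meaning stored energy $\varepsilon_l=l\,\varepsilon_\Delta$, $\varepsilon_\Delta=\varepsilon_T/L$. The energy states are the $N=(1+L)^K$ vectors $\vec s_n=[l_1^n,\dots,l_K^n]\in\{0,\dots,L\}^K$. A transmission uses $l_S$ energy levels, $1\le l_S\le L$ fixed, with transmit power $P_S=l_S\varepsilon_\Delta/T_0$. Let $\vartheta_n^{TH}=\{k: l_k^n\ge l_S\}$ be the set of (indices of) sources with sufficient energy in state $\vec s_n$, and $\Theta_1=\{\vec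 s_n:\vartheta_n^{TH}=\emptyset\}$ (non-information-transmission states), $\Theta_2=\{\vec s_n:\vartheta_n^{TH}\neq\emptyset\}$ (information-transmission states). $\eta>0$ is the energy conversion efficiency. Dynamics in one slot, starting from $\vec s_n$. (i) If $\vec s_n\in\Theta_1$, no source transmits and every source $k$ harvests $\varepsilon_k^n=\eta T_0P_B|\mathbf h_{BS_k}^T\mathbf w_1|^2$, where $\mathbf w_1$ has all entries $1/\sqrt{N_B}$; its new level is $\min\{L,\ l_k^n+\lfloor \varepsilon_k^n/\varepsilon_\Delta\rfloor\}$. (ii) If $\vec s_n\in\Theta_2$, the source with index $i^*=\arg\max_{k\in\vartheta_n^{TH}}|h_{S_kD}|^2$ transmits and its level decreases by $l_S$ (it does not harvest). Every other source $k\ne i^*$ harvests $\varepsilon_k^{n,i^*}=\eta T_0\left(P_S|h_{S_{i^*}S_k}|^2+P_B|\mathbf h_{BS_k}^T\mathbf w_2|^2\right)$, where $\mathbf w_2$ is a unit-norm vector, a function of $\mathbf h_{BD}$ only, with $\mathbf h_{BD}^T\mathbf w_2=0$; its new level is $\min\{L,\ l_k^n+\lfloor\varepsilon_k^{n,i^*}/\varepsilon_\Delta\rfloor\}$. The signal-to-noise ratio received at $D$ in this slot is $\gamma_D^{n,i^*}=\frac{P_S}{N_0}|h_{S_{i^*}D}|^2$, where $N_0>0$ is the noise power. The energy state thus evolves as a time-homogeneous Markov chain; $\mathbf A=(a_{n,n'})$, where $a_{n,n'}$ is the one-step probability of moving from $\vec s_n$ to $\vec s_{n'}$. It has a unique stationary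 distribution. Connection outage probability. Let $R_t>0$ (bits/s/Hz) be the transmission rate. The overall connection outage probability $P_{CO}$ is the probability, in the stationary regime of the chain, that in a slot a source actually transmits (state in $\Theta_2$) and the received signal-to-noise ratio satisfies $\gamma_D^{n,i^*}<\gamma_{th}^t=2^{R_t}-1$ (slots with no transmission contribute zero). *)

theory Defs
  imports "HOL-Probability.Probability"
begin

text \<open>
  The finite types \<open>'b\<close> and \<open>'k\<close> index the antennas of the power beacon and the sources, so the
  number of antennas is \<open>CARD('b)\<close> and the number of sources is \<open>CARD('k)\<close>.
\<close>

datatype ('b, 'k) link = BS 'b 'k | BD 'b | SD 'k | SS 'k 'k

text \<open>
  \<open>SS i k\<close> is the channel from source \<open>i\<close> to source \<open>k\<close>; there is no channel from a source to itself.
\<close>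

definition links :: "('b, 'k) link set" where
  "links = UNIV - range (\<lambda>k. SS k k)"

record ('b, 'k) network =
  beacon_power :: real
  slot_length :: real
  efficiency :: real
  capacity :: real
  max_level :: nat
  tx_levels :: nat
  noise_power :: real
  rate :: real
  mean_BS :: "'k \<Rightarrow> real"
  mean_BD :: real
  mean_SD :: "'k \<Rightarrow> real"
  mean_SS :: "'k \<Rightarrow> 'k \<Rightarrow> real"
  null_beam :: "complex ^ 'b \<Rightarrow> complex ^ 'b"

text \<open>
  The bilinear product \<open>h\<^sup>T w\<close>, without conjugation.
\<close>

definition tprod :: "complex ^ 'b \<Rightarrow> complex ^ 'b \<Rightarrow> complex" where
  "tprod h w = (\<Sum>b\<in>UNIV. h $ b * w $ b)"

definition valid_network :: "('b::finite, 'k::finite) network \<Rightarrow> bool" where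
  "valid_network nw \<longleftrightarrow>
     CARD('b) \<ge> 2 \<and>
     beacon_power nw > 0 \<and> slot_length nw > 0 \<and> efficiency nw > 0 \<and> capacity nw > 0 \<and>
     max_level nw \<ge> 1 \<and> 1 \<le> tx_levels nw \<and> tx_levels nw \<le> max_level nw \<and>
     noise_power nw > 0 \<and> rate nw > 0 \<and>
     (\<forall>k. mean_BS nw k > 0) \<and> mean_BD nw > 0 \<and> (\<forall>k. mean_SD nw k > 0) \<and>
     (\<forall>i k. i \<noteq> k \<longrightarrow> mean_SS nw i k > 0) \<and>
     null_beam nw \<in> borel_measurable borel \<and>
     (\<forall>h. norm (null_beam nw h) = 1 \<and> tprod h (null_beam nw h) = 0)"

definition quantum :: "('b::finite, 'k) network \<Rightarrow> real" where
  "quantum nw = capacity nw / real (max_level nw)"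

definition source_power :: "('b::finite, 'k) network \<Rightarrow> real" where
  "source_power nw = real (tx_levels nw) * quantum nw / slot_length nw"

definition snr_threshold :: "('b::finite, 'k) network \<Rightarrow> real" where
  "snr_threshold nw = 2 powr rate nw - 1"

definition energy_states :: "('b::finite, 'k) network \<Rightarrow> ('k \<Rightarrow> nat) set" where
  "energy_states nw = {l. \<forall>k. l k \<le> max_level nw}"

definition able_sources :: "('b::finite, 'k) network \<Rightarrow> ('k \<Rightarrow> nat) \<Rightarrow> 'k set" where
  "able_sources nw l = {k. tx_levels nw \<le> l k}"

definition transmission_states :: "('b::finite, 'k) network \<Rightarrow> ('k \<Rightarrow> nat) set" where
  "transmission_states nw = {l \<in> energy_states nw. able_sources nw l \<noteq> {}}"


text \<open>
  A map \<open>h\<close> from links to complex numbers is a realization of all channels in one slot. Ties in the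
  choice of the transmitting source have probability zero.
\<close>

definition vec_BS :: "(('b, 'k) link \<Rightarrow> complex) \<Rightarrow> 'k \<Rightarrow> complex ^ 'b" where
  "vec_BS h k = (\<chi> b. h (BS b k))"

definition vec_BD :: "(('b, 'k) link \<Rightarrow> complex) \<Rightarrow> complex ^ 'b" where
  "vec_BD h = (\<chi> b. h (BD b))"

definition uniform_beam :: "complex ^ 'b" where
  "uniform_beam = (\<chi> b. complex_of_real (1 / sqrt (real CARD('b))))"

definition selected ::
    "('b::finite, 'k) network \<Rightarrow> ('k \<Rightarrow> nat) \<Rightarrow> (('b, 'k) link \<Rightarrow> complex) \<Rightarrow> 'k" where
  "selected nw l h = arg_max_on (\<lambda>k. (cmod (h (SD k)))\<^sup>2) (able_sources nw l)"

definition idle_harvest ::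
    "('b::finite, 'k) network \<Rightarrow> (('b, 'k) link \<Rightarrow> complex) \<Rightarrow> 'k \<Rightarrow> real" where
  "idle_harvest nw h k =
     efficiency nw * slot_length nw * beacon_power nw * (cmod (tprod (vec_BS h k) uniform_beam))\<^sup>2"

definition busy_harvest ::
    "('b::finite, 'k) network \<Rightarrow> (('b, 'k) link \<Rightarrow> complex) \<Rightarrow> 'k \<Rightarrow> 'k \<Rightarrow> real" where
  "busy_harvest nw h i k =
     efficiency nw * slot_length nw *
       (source_power nw * (cmod (h (SS i k)))\<^sup>2 +
        beacon_power nw * (cmod (tprod (vec_BS h k) (null_beam nw (vec_BD h))))\<^sup>2)"

definition charge :: "('b::finite, 'k) network \<Rightarrow> nat \<Rightarrow> real \<Rightarrow> nat" where
  "charge nw l e = min (max_level nw) (l + nat \<lfloor>e / quantum nw\<rfloor>)"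

definition next_state ::
    "('b::finite, 'k) network \<Rightarrow> ('k \<Rightarrow> nat) \<Rightarrow> (('b, 'k) link \<Rightarrow> complex) \<Rightarrow> 'k \<Rightarrow> nat" where
  "next_state nw l h =
     (if able_sources nw l = {} then (\<lambda>k. charge nw (l k) (idle_harvest nw h k))
      else let i = selected nw l h in
        (\<lambda>k. if k = i then l k - tx_levels nw else charge nw (l k) (busy_harvest nw h i k)))"

definition snr ::
    "('b::finite, 'k) network \<Rightarrow> ('k \<Rightarrow> nat) \<Rightarrow> (('b, 'k) link \<Rightarrow> complex) \<Rightarrow> real" where
  "snr nw l h = source_power nw / noise_power nw * (cmod (h (SD (selected nw l h))))\<^sup>2"


text \<open>
  The circularly symmetric complex Gaussian law with mean square \<open>v\<close>: real and imaginary part are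
  independent and normal with mean zero and variance \<open>v / 2\<close>.
\<close>

definition complex_gaussian :: "real \<Rightarrow> complex measure" where
  "complex_gaussian v =
     (let N = density lborel (normal_density 0 (sqrt (v / 2)))
      in distr (N \<Otimes>\<^sub>M N) borel (\<lambda>(x, y). Complex x y))"

fun mean_gain :: "('b::finite, 'k) network \<Rightarrow> ('b, 'k) link \<Rightarrow> real" where
  "mean_gain nw (BS b k) = mean_BS nw k"
| "mean_gain nw (BD b) = mean_BD nw"
| "mean_gain nw (SD k) = mean_SD nw k"
| "mean_gain nw (SS i k) = mean_SS nw i k"

definition slot_law :: "('b::finite, 'k) network \<Rightarrow> (('b, 'k) link \<Rightarrow> complex) measure" where
  "slot_law nw = (\<Pi>\<^sub>M e\<in>links. complex_gaussian (mean_gain nw e))"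

text \<open>
  An enumeration \<open>s\<close> of the energy states by a finite type \<open>'n\<close> makes \<open>'n\<close> the index type of the
  transition matrix.
\<close>

definition transition_matrix ::
    "('b::finite, 'k::finite) network \<Rightarrow> ('n::finite \<Rightarrow> 'k \<Rightarrow> nat) \<Rightarrow> real ^ 'n ^ 'n" where
  "transition_matrix nw s =
     (\<chi> n n'. measure (slot_law nw) {h \<in> space (slot_law nw). next_state nw (s n) h = s n'})"

lemma card_energy_state_index:
  fixes nw :: "('b::finite, 'k::finite) network" and s :: "'n::finite \<Rightarrow> 'k \<Rightarrow> nat"
  assumes "bij_betw s UNIV (energy_states nw)"
  shows "CARD('n) = (1 + max_level nw) ^ CARD('k)"
proof -
  have "energy_states nw = PiE UNIV (\<lambda>_. {..max_level nw})"
    by (auto simp: energy_states_def PiE_def)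
  then have "card (energy_states nw) = (1 + max_level nw) ^ CARD('k)"
    by (simp add: card_PiE)
  then show ?thesis
    using bij_betw_same_card[OF assms] by simp
qed

definition stationary_distribution :: "real ^ 'n ^ 'n \<Rightarrow> real ^ 'n \<Rightarrow> bool" where
  "stationary_distribution A p \<longleftrightarrow>
     (\<forall>n. 0 \<le> p $ n) \<and> (\<Sum>n\<in>UNIV. p $ n) = 1 \<and> p v* A = p"

text \<open>
  \<open>H t e\<close> is the coefficient of link \<open>e\<close> in slot \<open>t\<close>, and \<open>X t\<close> is the energy state at the beginning
  of slot \<open>t\<close>. The initial state is independent of the channels of all slots.
\<close>

locale network_process = prob_space M
  for M :: "'w measure" +
  fixes nw :: "('b::finite, 'k::finite) network"
    and H :: "nat \<Rightarrow> ('b, 'k) link \<Rightarrow> 'w \<Rightarrow> complex"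
    and X :: "nat \<Rightarrow> 'w \<Rightarrow> 'k \<Rightarrow> nat"
  assumes valid: "valid_network nw"
    and channel_law: "\<And>t e. e \<in> links \<Longrightarrow> distr M borel (H t e) = complex_gaussian (mean_gain nw e)"
    and channel_indep: "indep_vars (\<lambda>_. borel) (\<lambda>(t, e). H t e) (UNIV \<times> links)"
    and initial_measurable: "X 0 \<in> measurable M (count_space UNIV)"
    and initial_indep:
      "indep_set
         (sets (vimage_algebra (space M) (X 0) (count_space UNIV)))
         (sets (vimage_algebra (space M) (\<lambda>\<omega>. \<lambda>(t, e)\<in>UNIV \<times> links. H t e \<omega>)
           (\<Pi>\<^sub>M te\<in>UNIV \<times> links. borel)))"
    and initial_state: "\<And>\<omega>. \<omega> \<in> space M \<Longrightarrow> X 0 \<omega> \<in> energy_states nw"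
    and dynamics: "\<And>t \<omega>. \<omega> \<in> space M \<Longrightarrow> X (Suc t) \<omega> = next_state nw (X t \<omega>) (\<lambda>e. H t e \<omega>)"

definition state_law :: "'w measure \<Rightarrow> ('n::finite \<Rightarrow> 'k \<Rightarrow> nat) \<Rightarrow> ('w \<Rightarrow> 'k \<Rightarrow> nat) \<Rightarrow> real ^ 'n" where
  "state_law M s Y = (\<chi> n. measure M {\<omega> \<in> space M. Y \<omega> = s n})"

definition connection_outage_prob ::
    "'w measure \<Rightarrow> ('b::finite, 'k) network \<Rightarrow> (nat \<Rightarrow> ('b, 'k) link \<Rightarrow> 'w \<Rightarrow> complex) \<Rightarrow>
     (nat \<Rightarrow> 'w \<Rightarrow> 'k \<Rightarrow> nat) \<Rightarrow> nat \<Rightarrow> real" where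
  "connection_outage_prob M nw H X t =
     measure M {\<omega> \<in> space M. X t \<omega> \<in> transmission_states nw \<and>
                  snr nw (X t \<omega>) (\<lambda>e. H t e \<omega>) < snr_threshold nw}"

end

theory Submission
  imports Defs "HOL-Real_Asymp.Real_Asymp"
begin

text \<open>
  The state at the beginning of slot \<open>t\<close> is independent of the channels from slot \<open>t\<close> on, so the
  state laws evolve by the transition matrix \<open>A\<close> and the stationary initial law \<open>\<pi>\<close> persists. Since
  the transmitter has the largest gain among the able sources, outage means that all their gains,
  which are independent exponential variables, lie below the threshold.

  Invertibility is proved for the transpose \<open>A - E + Q\<close>: pairing a kernel vector \<open>y\<close> with \<open>\<pi>\<close> gives
  \<open>\<Sum>y = 0\<close>, so \<open>y\<close> is harmonic. The fully charged state lies in every nonempty closed set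
  of states: small harvests drain the sources until none can transmit, and then one large harvest
  fills all of them. By the maximum principle \<open>y\<close> is constant, hence zero.
\<close>

section \<open>Invertibility from the maximum principle\<close>

text \<open>Where a harmonic \<open>y\<close> is maximal, its value is an average of values that are
  no larger, so every successor of positive probability is a maximiser too. The maximisers form a
  closed set, and \<open>closed\<close> puts \<open>r\<close> into it. That hypothesis expresses,
  without paths, that \<open>r\<close> can be reached from every state.\<close>

lemma harmonic_le_at_reachable:
  fixes A :: "real ^ 'n ^ 'n"
  assumes nonneg: "\<And>i j. 0 \<le> A $ i $ j"
    and row: "\<And>i. (\<Sum>j\<in>UNIV. A $ i $ j) = 1"
    and closed: "\<And>C. C \<noteq> {} \<Longrightarrow> (\<And>i j. i \<in> C \<Longrightarrow> A $ i $ j > 0 \<Longrightarrow> j \<in> C) \<Longrightarrow> r \<in> C"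
    and harmonic: "A *v y = y"
  shows "y $ i \<le> y $ r"
proof -
  define m where "m = Max (range (\<lambda>i. y $ i))"
  have le: "y $ i \<le> m" for i
    by (simp add: m_def)
  have "m \<in> range (\<lambda>i. y $ i)"
    unfolding m_def by (intro Max_in) auto
  then have ne: "{i. y $ i = m} \<noteq> {}" by auto
  have "r \<in> {i. y $ i = m}"
  proof (rule closed[OF ne])
    fix i j assume i: "i \<in> {i. y $ i = m}" and ij: "A $ i $ j > 0"
    \<comment> \<open>Row sum one and harmonicity make the weighted gaps \<open>m - y $ j\<close>
      add up to zero; being nonnegative, each of them vanishes.\<close>
    have "(\<Sum>j\<in>UNIV. A $ i $ j * (m - y $ j)) = m * (\<Sum>j\<in>UNIV. A $ i $ j) - (A *v y) $ i"
      by (simp add: algebra_simps sum_subtractf sum_distrib_left matrix_vector_mult_def)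
    also have "\<dots> = 0"
      using i by (simp add: row harmonic)
    finally have "A $ i $ j * (m - y $ j) = 0"
      using nonneg le by (subst (asm) sum_nonneg_eq_0_iff) auto
    then show "j \<in> {i. y $ i = m}" using ij by auto
  qed
  then show ?thesis using le by simp
qed

lemma invertible_stationary_matrix:
  fixes A :: "real ^ 'n ^ 'n"
  assumes nonneg: "\<And>i j. 0 \<le> A $ i $ j"
    and row: "\<And>i. (\<Sum>j\<in>UNIV. A $ i $ j) = 1"
    and closed: "\<And>C. C \<noteq> {} \<Longrightarrow> (\<And>i j. i \<in> C \<Longrightarrow> A $ i $ j > 0 \<Longrightarrow> j \<in> C) \<Longrightarrow> r \<in> C"
    and p: "stationary_distribution A p"
  shows "invertible (transpose A - mat 1 + (\<chi> i j. 1))"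
proof -
  let ?B = "A - mat 1 + (\<chi> i j. 1)"
  have "y = 0" if y: "?B *v y = 0" for y
  proof -
    define \<sigma> where "\<sigma> = (\<Sum>j\<in>UNIV. y $ j)"
    have *: "?B *v y = A *v y - y + (\<chi> i. \<sigma>)"
      by (simp add: matrix_vector_mult_add_rdistrib matrix_vector_mult_diff_rdistrib)
         (simp add: matrix_vector_mult_def vec_eq_iff \<sigma>_def)
    \<comment> \<open>\<open>p v* A = p\<close> cancels the first two terms below, and total mass
      one turns the constant vector into \<open>\<sigma>\<close>.\<close>
    have "0 = inner p (?B *v y)" by (simp add: y)
    also have "\<dots> = inner (p v* A) y - inner p y + \<sigma>"
      using p unfolding *
      by (simp add: inner_add_right inner_diff_right dot_lmul_matrix)
         (simp add: inner_vec_def stationary_distribution_def flip: sum_distrib_right)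
    finally have \<sigma>: "\<sigma> = 0" using p by (simp add: stationary_distribution_def)
    then have h: "A *v y = y" using y * by (simp add: vec_eq_iff)
    \<comment> \<open>Negation exchanges maximum and minimum, so the same lemma bounds
      \<open>y\<close> from below by its value at \<open>r\<close>.\<close>
    then have h': "A *v (- y) = - y"
      by (simp add: matrix_vector_mult_def vec_eq_iff sum_negf)
    have "y $ i = y $ r" for i
      using harmonic_le_at_reachable[OF nonneg row closed h, of i]
        harmonic_le_at_reachable[OF nonneg row closed h', of i] by (simp add: antisym)
    moreover from this have "real CARD('n) * y $ r = \<sigma>"
      unfolding \<sigma>_def by (subst sum.cong[OF refl, of UNIV _ "\<lambda>_. y $ r"]) auto
    ultimately show ?thesis using \<sigma> by (simp add: vec_eq_iff)
  qed
  \<comment> \<open>A trivial kernel suffices for a square matrix. Transposing changes only the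
    \<open>A\<close> term, as the identity and the all-ones matrix are symmetric.\<close>
  then have "invertible ?B"
    unfolding invertible_left_inverse matrix_left_invertible_ker by blast
  then have "invertible (transpose ?B)" by (rule transpose_invertible)
  also have "transpose ?B = transpose A - mat 1 + (\<chi> i j. 1)"
    by (auto simp add: transpose_def vec_eq_iff mat_def)
  finally show ?thesis .
qed

text \<open>Stationarity means that \<open>transpose A - mat 1\<close> kills \<open>p\<close>, and
  total mass one means that the all-ones matrix sends \<open>p\<close> to the all-ones vector.
  Adding the two gives a single linear system solved by \<open>p\<close>.\<close>

lemma stationary_eq_matrix_inv:
  fixes A :: "real ^ 'n ^ 'n"
  assumes inv: "invertible (transpose A - mat 1 + (\<chi> i j. 1))"
    and p: "stationary_distribution A p"
  shows "matrix_inv (transpose A - mat 1 + (\<chi> i j. 1)) *v (\<chi> i. 1) = p"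
proof -
  let ?B = "transpose A - mat 1 + (\<chi> i j. 1) :: real ^ 'n ^ 'n"
  have "?B *v p = p v* A - p + (\<chi> i. (\<Sum>j\<in>UNIV. p $ j))"
    by (simp add: matrix_vector_mult_add_rdistrib matrix_vector_mult_diff_rdistrib)
       (simp add: matrix_vector_mult_def vec_eq_iff)
  also have "\<dots> = (\<chi> i. 1)"
    using p by (simp add: stationary_distribution_def)
  finally have "matrix_inv ?B *v (\<chi> i. 1) = matrix_inv ?B *v (?B *v p)" by simp
  also have "\<dots> = (matrix_inv ?B ** ?B) *v p"
    by (simp add: matrix_vector_mul_assoc)
  also have "matrix_inv ?B ** ?B = mat 1"
    using inv unfolding invertible_def matrix_inv_def by (rule someI2_ex) simp
  finally show ?thesis by simp
qed

section \<open>The squared modulus of a complex Gaussian variable\<close>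

lemma sets_complex_gaussian [simp, measurable_cong]: "sets (complex_gaussian v) = sets borel"
  by (simp add: complex_gaussian_def Let_def)

lemma space_complex_gaussian [simp]: "space (complex_gaussian v) = UNIV"
  by (simp add: complex_gaussian_def Let_def)

lemma measurable_Complex [measurable (raw)]:
  assumes "f \<in> borel_measurable M" "g \<in> borel_measurable M"
  shows "(\<lambda>x. Complex (f x) (g x)) \<in> borel_measurable M"
  using assms by (simp add: borel_measurable_complex_iff)

lemma prob_space_complex_gaussian:
  assumes "v > 0"
  shows "prob_space (complex_gaussian v)"
proof -
  let ?N = "density lborel (\<lambda>x. ennreal (normal_density 0 (sqrt (v / 2)) x))"
  interpret N: prob_space ?N
    using assms by (intro prob_space_normal_density) simp
  interpret NN: pair_prob_space ?N ?N ..
  show ?thesis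
    unfolding complex_gaussian_def Let_def
    by (intro NN.prob_space_distr) measurable
qed

text \<open>The annulus is a closed disc minus an open one, with areas \<open>pi * u\<close> and
  \<open>pi * x\<close>.\<close>

lemma emeasure_lborel_annulus:
  fixes x u :: real
  assumes "0 \<le> x" "x \<le> u"
  shows "emeasure lborel {p :: real \<times> real. x \<le> (norm p)\<^sup>2 \<and> (norm p)\<^sup>2 \<le> u} = ennreal (pi * (u - x))"
proof -
  have c: "(norm p)\<^sup>2 \<le> a \<longleftrightarrow> norm p \<le> sqrt a" "a \<le> (norm p)\<^sup>2 \<longleftrightarrow> sqrt a \<le> norm p"
    if "0 \<le> a" for a and p :: "real \<times> real"
    by (metis abs_norm_cancel real_sqrt_abs real_sqrt_le_iff)
       (metis abs_norm_cancel real_sqrt_abs real_sqrt_le_iff)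
  have "{p :: real \<times> real. x \<le> (norm p)\<^sup>2 \<and> (norm p)\<^sup>2 \<le> u} = cball 0 (sqrt u) - ball 0 (sqrt x)"
    using assms by (auto simp: c)
  also have "emeasure lborel \<dots>
      = emeasure lborel (cball (0 :: real \<times> real) (sqrt u)) - emeasure lborel (ball (0 :: real \<times> real) (sqrt x))"
  proof (rule emeasure_Diff)
    have "sqrt x \<le> sqrt u" using assms by simp
    then show "ball (0 :: real \<times> real) (sqrt x) \<subseteq> cball 0 (sqrt u)"
      by (rule order.trans[OF subset_ball ball_subset_cball])
  qed (use assms in \<open>auto simp: emeasure_ball\<close>)
  also have "\<dots> = ennreal (pi * u) - ennreal (pi * x)"
    using assms by (simp add: emeasure_ball emeasure_cball unit_ball_vol_2)
  also have "\<dots> = ennreal (pi * (u - x))"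
    using assms by (simp add: ennreal_minus right_diff_distrib)
  finally show ?thesis .
qed

text \<open>
  Writing \<open>exp (- |z|\<^sup>2 / v)\<close> as an integral over \<open>u \<ge> |z|\<^sup>2\<close> and exchanging the integrals avoids
  polar coordinates: only areas of annuli are needed.
\<close>

lemma emeasure_complex_gaussian_tail:
  assumes v: "v > 0" and x: "x \<ge> 0"
  shows "emeasure (complex_gaussian v) {z. x \<le> (cmod z)\<^sup>2} = ennreal (exp (- x / v))"
proof -
  let ?d = "normal_density 0 (sqrt (v / 2))"
  let ?g = "\<lambda>u. ennreal (exp (- u / v) / (pi * v\<^sup>2))"
  let ?S = "{p :: real \<times> real. x \<le> (norm p)\<^sup>2}"
  let ?R = "\<lambda>u. {p :: real \<times> real. x \<le> (norm p)\<^sup>2 \<and> (norm p)\<^sup>2 \<le> u}"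
  let ?N = "density lborel (\<lambda>x. ennreal (?d x))"
  interpret N: prob_space ?N
    using v by (intro prob_space_normal_density) simp
  \<comment> \<open>Variance \<open>v / 2\<close> in each component makes the joint density
    radial.\<close>
  have dens: "?d a * ?d b = exp (- (norm (a, b))\<^sup>2 / v) / (pi * v)" for a b
    using v by (simp add: normal_density_def norm_Pair real_sqrt_mult flip: exp_add)
       (simp add: field_simps flip: exp_add)
  \<comment> \<open>\<open>?g\<close> is the negated derivative of
    \<open>exp (- u / v) / (pi * v)\<close>, so integrating it over \<open>u \<ge> s\<close>
    recovers the radial density at squared radius \<open>s\<close>.\<close>
  have tail: "ennreal (exp (- s / v) / (pi * v)) =
      (\<integral>\<^sup>+u. ?g u * indicator {s..} u \<partial>lborel)" for s
  proof -
    have "(\<integral>\<^sup>+u. ?g u * indicator {s..} u \<partial>lborel)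
        = ennreal (0 - (- exp (- s / v) / (pi * v)))"
    proof (rule nn_integral_FTC_atLeast)
      show "((\<lambda>u. - exp (- u / v) / (pi * v)) \<longlongrightarrow> 0) at_top"
        using v by real_asymp
      show "((\<lambda>u. - exp (- u / v) / (pi * v)) has_real_derivative exp (- u / v) / (pi * v\<^sup>2)) (at u)" for u
        using v by (auto intro!: derivative_eq_intros simp: power2_eq_square)
    qed auto
    then show ?thesis by simp
  qed
  have "emeasure (complex_gaussian v) {z. x \<le> (cmod z)\<^sup>2}
      = emeasure (?N \<Otimes>\<^sub>M ?N) ?S"
    unfolding complex_gaussian_def Let_def
    by (subst emeasure_distr)
       (auto simp: space_pair_measure cmod_def norm_Pair intro!: arg_cong2[where f = emeasure])
  also have "?N \<Otimes>\<^sub>M ?N = density lborel (\<lambda>(x, y). ennreal (?d x) * ennreal (?d y))"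
    by (subst pair_measure_density)
      (auto simp: lborel_prod intro: lborel.sigma_finite_measure_axioms N.sigma_finite_measure_axioms)
  also have "(\<lambda>(x, y). ennreal (?d x) * ennreal (?d y)) = (\<lambda>p. ennreal (exp (- (norm p)\<^sup>2 / v) / (pi * v)))"
    by (auto simp: fun_eq_iff dens simp flip: ennreal_mult)
  also have "emeasure (density lborel \<dots>) ?S =
     (\<integral>\<^sup>+p. ennreal (exp (- (norm p)\<^sup>2 / v) / (pi * v)) * indicator ?S p \<partial>lborel)"
    by (subst emeasure_density) auto
  also have "\<dots> = (\<integral>\<^sup>+p. \<integral>\<^sup>+u. ?g u * indicator {(norm p)\<^sup>2..} u * indicator ?S p \<partial>lborel \<partial>lborel)"
    by (subst tail, subst nn_integral_multc) auto
  also have "\<dots> = (\<integral>\<^sup>+u. \<integral>\<^sup>+p. ?g u * indicator {(norm p)\<^sup>2..} u * indicator ?S p \<partial>lborel \<partial>lborel)"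
  proof (rule lborel_pair.Fubini'[symmetric])
    have [measurable]: "Measurable.pred (borel \<Otimes>\<^sub>M borel) (\<lambda>q :: (real \<times> real) \<times> real.
        snd q \<in> {(norm (fst q))\<^sup>2..})"
      unfolding atLeast_iff by measurable
    have [measurable]: "?S \<in> sets borel"
      by measurable
    show "(\<lambda>(p, u). ?g u * indicator {(norm p)\<^sup>2..} u * indicator ?S p)
        \<in> borel_measurable (lborel \<Otimes>\<^sub>M lborel)"
      by measurable
  qed
  \<comment> \<open>For fixed \<open>u\<close> the remaining points fill the annulus between the
    squared radii \<open>x\<close> and \<open>u\<close>, which is empty for \<open>u < x\<close>;
    its area cancels the factor \<open>pi\<close>.\<close>
  also have "\<dots> = (\<integral>\<^sup>+u. ennreal (exp (- u / v) * (u - x) / v\<^sup>2) * indicator {x..} u \<partial>lborel)"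
  proof (rule nn_integral_cong)
    fix u :: real
    have "(\<integral>\<^sup>+p. ?g u * indicator {(norm p)\<^sup>2..} u * indicator ?S p \<partial>lborel)
      = (\<integral>\<^sup>+p. ?g u * indicator (?R u) p \<partial>lborel)"
      by (intro nn_integral_cong) (auto simp: indicator_def)
    also have "\<dots> = ?g u * emeasure lborel (?R u)"
      by (intro nn_integral_cmult_indicator) measurable
    also have "\<dots> = ennreal (exp (- u / v) * (u - x) / v\<^sup>2) * indicator {x..} u"
    proof (cases "x \<le> u")
      case True
      then show ?thesis using x v by (simp add: emeasure_lborel_annulus flip: ennreal_mult)
    next
      case False
      then have "?R u = {}" by auto
      then have "emeasure lborel (?R u) = 0" by (simp only: emeasure_empty)
      then show ?thesis using False by simp
    qed
    finally show "(\<integral>\<^sup>+p. ?g u * indicator {(norm p)\<^sup>2..} u * indicator ?S p \<partial>lborel) = \<dots>" .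
  qed
  also have "\<dots> = ennreal (0 - (- (x - x + v) * exp (- x / v) / v))"
  proof (rule nn_integral_FTC_atLeast[where F = "\<lambda>u. - (u - x + v) * exp (- u / v) / v"])
    show "((\<lambda>u. - (u - x + v) * exp (- u / v) / v) \<longlongrightarrow> 0) at_top"
      using v by real_asymp
    show "((\<lambda>u. - (u - x + v) * exp (- u / v) / v) has_real_derivative exp (- u / v) * (u - x) / v\<^sup>2) (at u)" for u
      using v by (auto intro!: derivative_eq_intros simp: power2_eq_square field_simps)
  qed auto
  finally show ?thesis using v by simp
qed

text \<open>This tail identifies the squared modulus as an exponential variable with mean
  \<open>v\<close>.\<close>

lemma measure_complex_gaussian_tail:
  assumes "v > 0" "x \<ge> 0"
  shows "measure (complex_gaussian v) {z. x \<le> (cmod z)\<^sup>2} = exp (- x / v)"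
  using emeasure_complex_gaussian_tail[OF assms] by (simp add: measure_def)

lemma measure_complex_gaussian_disc:
  assumes "v > 0" "x \<ge> 0"
  shows "measure (complex_gaussian v) {z. (cmod z)\<^sup>2 < x} = 1 - exp (- x / v)"
proof -
  interpret prob_space "complex_gaussian v"
    by (rule prob_space_complex_gaussian) fact
  have "{z. (cmod z)\<^sup>2 < x} = space (complex_gaussian v) - {z. x \<le> (cmod z)\<^sup>2}"
    by auto
  then show ?thesis
    using assms prob_compl[of "{z. x \<le> (cmod z)\<^sup>2}"]
    by (simp only: measure_complex_gaussian_tail) simp
qed

section \<open>The law of one slot\<close>

lemma finite_link: "finite (S :: ('b::finite, 'k::finite) link set)"
proof (rule finite_subset[OF subset_UNIV])
  have "e \<in> range (\<lambda>(b, k). BS b k) \<union> range BD \<union> range SD \<union> range (\<lambda>(i, k). SS i k)" for e :: "('b, 'k) link"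
    by (cases e) auto
  then have "(UNIV :: ('b, 'k) link set) = range (\<lambda>(b, k). BS b k) \<union> range BD \<union> range SD \<union> range (\<lambda>(i, k). SS i k)"
    by blast
  then show "finite (UNIV :: ('b, 'k) link set)" by (metis finite finite_UnI finite_imageI)
qed

lemma in_links [simp]:
  "BS b k \<in> links" "BD b \<in> links" "SD k \<in> links" "SS i k \<in> links \<longleftrightarrow> i \<noteq> k"
  by (auto simp: links_def)

lemma mean_gain_pos: "valid_network nw \<Longrightarrow> e \<in> links \<Longrightarrow> mean_gain nw e > 0"
  by (cases e) (auto simp: valid_network_def)

lemma sets_slot_law: "sets (slot_law nw) = sets (\<Pi>\<^sub>M e\<in>links. borel)"
  unfolding slot_law_def by (rule sets_PiM_cong) simp_all

lemma space_slot_law: "space (slot_law nw) = PiE links (\<lambda>_. UNIV)"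
  by (simp add: slot_law_def space_PiM)

lemma measurable_slot_component:
  "e \<in> links \<Longrightarrow> (\<lambda>h. h e) \<in> borel_measurable (slot_law nw)"
  by (simp add: measurable_cong_sets[OF sets_slot_law refl])

lemma
  fixes nw :: "('b::finite, 'k::finite) network"
  assumes valid: "valid_network nw"
  shows prob_space_slot_law: "prob_space (slot_law nw)"
    and measure_slot_law_box: "(\<And>e. e \<in> links \<Longrightarrow> A e \<in> sets borel) \<Longrightarrow>
      measure (slot_law nw) (PiE links A) =
        (\<Prod>e\<in>links. measure (complex_gaussian (mean_gain nw e)) (A e))"
proof -
  \<comment> \<open>A self link may carry a nonpositive mean gain. Off \<open>links\<close> the
    variance is set to 1, so that every factor of the family is a probability measure; the product
    over \<open>links\<close> is unchanged.\<close>
  define N where "N = (\<lambda>e. complex_gaussian (if e \<in> links then mean_gain nw e else 1))"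
  have law: "slot_law nw = PiM links N"
    unfolding slot_law_def N_def by (rule PiM_cong) auto
  interpret N: product_prob_space N
    using mean_gain_pos[OF valid]
    by (intro product_prob_spaceI) (simp add: N_def prob_space_complex_gaussian)
  show "prob_space (slot_law nw)"
    unfolding law by (rule prob_space_PiM) (rule N.prob_space)
  assume A: "\<And>e. e \<in> links \<Longrightarrow> A e \<in> sets borel"
  interpret F: finite_product_prob_space N links
    by standard (rule finite_link)
  have "measure (slot_law nw) (PiE links A) = (\<Prod>e\<in>links. measure (N e) (A e))"
    unfolding law by (rule F.prob_times) (auto simp: N_def A)
  then show "measure (slot_law nw) (PiE links A) =
      (\<Prod>e\<in>links. measure (complex_gaussian (mean_gain nw e)) (A e))"
    by (simp add: N_def)
qed

section \<open>Measurability of the selection, the harvests and the next state\<close>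

lemma borel_measurable_vec_lambda:
  fixes f :: "'n::finite \<Rightarrow> 'a \<Rightarrow> 'b::euclidean_space"
  assumes "\<And>i. f i \<in> borel_measurable M"
  shows "(\<lambda>x. \<chi> i. f i x) \<in> borel_measurable M"
proof (subst borel_measurable_euclidean_space, rule ballI)
  fix u :: "'b ^ 'n" assume "u \<in> Basis"
  then obtain i b where u: "u = axis i b" by (auto simp: Basis_vec_def)
  show "(\<lambda>x. (\<chi> i. f i x) \<bullet> u) \<in> borel_measurable M"
    unfolding u inner_axis vec_lambda_beta
    by (intro borel_measurable_inner assms borel_measurable_const)
qed

lemma borel_measurable_vec_nth:
  fixes f :: "'a \<Rightarrow> 'b::euclidean_space ^ 'n"
  assumes "f \<in> borel_measurable M"
  shows "(\<lambda>x. f x $ i) \<in> borel_measurable M"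
  by (rule measurable_compose[OF assms])
     (intro borel_measurable_continuous_onI linear_continuous_on bounded_linear_vec_nth)

text \<open>Each fibre is a finite intersection of membership events or their complements. This
  serves for the set of maximisers behind \<open>selected\<close>.\<close>

lemma measurable_Collect_finite:
  fixes P :: "'a \<Rightarrow> 'k::finite \<Rightarrow> bool"
  assumes [measurable]: "\<And>k. Measurable.pred M (\<lambda>x. P x k)"
  shows "(\<lambda>x. {k. P x k}) \<in> measurable M (count_space UNIV)"
proof (subst measurable_count_space_eq2; safe?)
  fix S
  have "(\<lambda>x. {k. P x k}) -` {S} \<inter> space M = {x \<in> space M. \<forall>k. P x k = (k \<in> S)}"
    by auto
  also have "\<dots> \<in> sets M" by measurable
  finally show "(\<lambda>x. {k. P x k}) -` {S} \<inter> space M \<in> sets M" .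
qed auto

text \<open>A maximiser exists among the finitely many able sources, so the choice in
  \<open>arg_max_on\<close> returns one, however ties are resolved.\<close>

lemma
  fixes nw :: "('b::finite, 'k::finite) network"
  assumes "able_sources nw l \<noteq> {}"
  shows selected_able: "selected nw l h \<in> able_sources nw l"
    and selected_max: "k \<in> able_sources nw l \<Longrightarrow>
      (cmod (h (SD k)))\<^sup>2 \<le> (cmod (h (SD (selected nw l h))))\<^sup>2"
proof -
  let ?f = "\<lambda>k. (cmod (h (SD k)))\<^sup>2"
  have "Max (?f ` able_sources nw l) \<in> ?f ` able_sources nw l"
    using assms by (intro Max_in) auto
  then obtain k0 where k0: "k0 \<in> able_sources nw l" "?f k0 = Max (?f ` able_sources nw l)"
    by auto
  then have "is_arg_max ?f (\<lambda>k. k \<in> able_sources nw l) k0"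
    by (simp add: is_arg_max_linorder)
  then have "is_arg_max ?f (\<lambda>k. k \<in> able_sources nw l) (selected nw l h)"
    unfolding selected_def arg_max_on_def arg_max_def by (rule someI)
  then show "selected nw l h \<in> able_sources nw l"
    "k \<in> able_sources nw l \<Longrightarrow> ?f k \<le> ?f (selected nw l h)"
    by (auto simp: is_arg_max_linorder)
qed

lemma measurable_selected:
  fixes nw :: "('b::finite, 'k::finite) network"
  shows "selected nw l \<in> measurable (slot_law nw) (count_space UNIV)"
proof -
  have [measurable]:
      "Measurable.pred (slot_law nw) (\<lambda>h. (cmod (h (SD i)))\<^sup>2 \<le> (cmod (h (SD k)))\<^sup>2)" for i k
  proof -
    have "(\<lambda>h. (cmod (h (SD j)))\<^sup>2) \<in> borel_measurable (slot_law nw)" for j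
      by (intro borel_measurable_power measurable_compose[OF measurable_slot_component borel_measurable_norm]) simp
    then show ?thesis
      unfolding pred_def by (intro borel_measurable_le)
  qed
  have "(\<lambda>h. {k. is_arg_max (\<lambda>k. (cmod (h (SD k)))\<^sup>2) (\<lambda>k. k \<in> able_sources nw l) k})
      \<in> measurable (slot_law nw) (count_space UNIV)"
    unfolding is_arg_max_linorder by (intro measurable_Collect_finite) measurable
  \<comment> \<open>The choice depends on \<open>h\<close> only through the set of maximisers, and
    every function on a discrete space is measurable.\<close>
  then have "(\<lambda>h. SOME k. k \<in> {k. is_arg_max (\<lambda>k. (cmod (h (SD k)))\<^sup>2) (\<lambda>k. k \<in> able_sources nw l) k})
      \<in> measurable (slot_law nw) (count_space UNIV)"
    by (rule measurable_compose) simp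
  then show ?thesis
    by (simp add: selected_def[abs_def] arg_max_on_def arg_max_def)
qed

lemma measurable_charge: "charge nw l \<in> measurable borel (count_space UNIV)"
  unfolding charge_def[abs_def] by measurable

lemma measurable_vec_BS: "(\<lambda>h. vec_BS h k) \<in> borel_measurable (slot_law nw)"
  unfolding vec_BS_def by (intro borel_measurable_vec_lambda measurable_slot_component) simp

lemma measurable_vec_BD: "vec_BD \<in> borel_measurable (slot_law nw)"
  unfolding vec_BD_def[abs_def] by (intro borel_measurable_vec_lambda measurable_slot_component) simp

lemma measurable_tprod:
  assumes "f \<in> borel_measurable M" "g \<in> borel_measurable M"
  shows "(\<lambda>x. tprod (f x) (g x)) \<in> borel_measurable M"
  unfolding tprod_def
  by (intro borel_measurable_sum borel_measurable_times borel_measurable_vec_nth assms)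

lemma measurable_idle_harvest: "(\<lambda>h. idle_harvest nw h k) \<in> borel_measurable (slot_law nw)"
proof -
  have [measurable]: "(\<lambda>h. tprod (vec_BS h k) uniform_beam) \<in> borel_measurable (slot_law nw)"
    by (intro measurable_tprod measurable_vec_BS) simp
  show ?thesis unfolding idle_harvest_def by measurable
qed

lemma measurable_busy_harvest:
  assumes "valid_network nw" "i \<noteq> k"
  shows "(\<lambda>h. busy_harvest nw h i k) \<in> borel_measurable (slot_law nw)"
proof -
  have "null_beam nw \<in> borel_measurable borel"
    using assms by (simp add: valid_network_def)
  then have [measurable]: "(\<lambda>h. tprod (vec_BS h k) (null_beam nw (vec_BD h))) \<in> borel_measurable (slot_law nw)"
    by (intro measurable_tprod measurable_vec_BS measurable_compose[OF measurable_vec_BD])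
  have [measurable]: "(\<lambda>h. h (SS i k)) \<in> borel_measurable (slot_law nw)"
    using assms by (intro measurable_slot_component) simp
  show ?thesis unfolding busy_harvest_def by measurable
qed

lemma measurable_next_state:
  fixes nw :: "('b::finite, 'k::finite) network"
  assumes "valid_network nw"
  shows "next_state nw l \<in> measurable (slot_law nw) (count_space UNIV)"
proof -
  have comp: "(\<lambda>h. next_state nw l h k) \<in> measurable (slot_law nw) (count_space UNIV)" for k
  proof (cases "able_sources nw l = {}")
    case True
    then show ?thesis
      unfolding next_state_def
      by (simp add: measurable_compose[OF measurable_idle_harvest measurable_charge])
  next
    case False
    \<comment> \<open>The transmitter takes finitely many values, so its index may be frozen. The
      case \<open>k = i\<close> is constant in \<open>h\<close> and leaves only links between
      distinct sources.\<close>
    have "(\<lambda>h. (\<lambda>i h. if k = i then l k - tx_levels nw else charge nw (l k) (busy_harvest nw h i k))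
        (selected nw l h) h) \<in> measurable (slot_law nw) (count_space UNIV)"
    proof (rule measurable_compose_countable'[OF _ measurable_selected])
      fix i
      show "(\<lambda>h. if k = i then l k - tx_levels nw else charge nw (l k) (busy_harvest nw h i k))
          \<in> measurable (slot_law nw) (count_space UNIV)"
      proof (cases "k = i")
        case False
        then show ?thesis
          using measurable_compose[OF measurable_busy_harvest[OF assms, of i k] measurable_charge]
          by simp
      qed simp
    qed (simp add: countable_finite)
    then show ?thesis
      unfolding next_state_def using False by (simp add: Let_def)
  qed
  show ?thesis
  \<comment> \<open>There are countably many level vectors, so fibres of single vectors are enough;
    each is a finite intersection over the sources.\<close>
  proof (subst measurable_count_space_eq_countable; safe?)
    fix l'
    have "next_state nw l -` {l'} \<inter> space (slot_law nw) =
        {h \<in> space (slot_law nw). \<forall>k. next_state nw l h k = l' k}"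
      by (auto simp: fun_eq_iff)
    also have "\<dots> \<in> sets (slot_law nw)"
      using comp by measurable
    finally show "next_state nw l -` {l'} \<inter> space (slot_law nw) \<in> sets (slot_law nw)" .
  qed auto
qed

lemma next_state_event:
  fixes nw :: "('b::finite, 'k::finite) network"
  assumes "valid_network nw"
  shows "{h \<in> space (slot_law nw). next_state nw l h = l'} \<in> sets (slot_law nw)"
  using measurable_sets[OF measurable_next_state[OF assms], of "{l'}" l]
  by (simp add: vimage_def Collect_conj_eq Int_commute)

section \<open>Transitions of positive probability\<close>

text \<open>The triangle inequality and \<open>|w $ b| \<le> 1\<close> give a crude bound, enough to
  force small harvests on an event of positive probability.\<close>

lemma tprod_bound:
  fixes h w :: "complex ^ 'b"
  assumes "\<And>b. (cmod (h $ b))\<^sup>2 \<le> d" "norm w = 1"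
  shows "(cmod (tprod h w))\<^sup>2 \<le> (real CARD('b))\<^sup>2 * d"
proof -
  have d: "d \<ge> 0" using assms(1)[of undefined] by (meson order.trans zero_le_power2)
  have "cmod (tprod h w) \<le> (\<Sum>b\<in>UNIV. cmod (h $ b) * cmod (w $ b))"
    unfolding tprod_def by (intro order.trans[OF norm_sum] sum_mono) (simp add: norm_mult)
  also have "\<dots> \<le> (\<Sum>b\<in>(UNIV :: 'b set). sqrt d * 1)"
    using assms(1) Finite_Cartesian_Product.norm_nth_le[of w] d
    by (intro sum_mono mult_mono) (auto simp: assms(2) real_le_rsqrt)
  finally have "(cmod (tprod h w))\<^sup>2 \<le> (real CARD('b) * sqrt d)\<^sup>2"
    by (intro power_mono) auto
  then show ?thesis using d by (simp add: power_mult_distrib)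
qed

lemma quantum_pos: "valid_network nw \<Longrightarrow> quantum nw > 0"
  by (simp add: valid_network_def quantum_def)

lemma source_power_pos: "valid_network nw \<Longrightarrow> source_power nw > 0"
  using quantum_pos[of nw] by (simp add: valid_network_def source_power_def)

lemma charge_less_quantum:
  assumes "valid_network nw" "l \<le> max_level nw" "0 \<le> e" "e < quantum nw"
  shows "charge nw l e = l"
proof -
  have "\<lfloor>e / quantum nw\<rfloor> = 0"
    using assms quantum_pos[OF assms(1)] by (simp add: floor_eq_iff)
  then show ?thesis using assms by (simp add: charge_def)
qed

lemma charge_full:
  assumes "valid_network nw" "real (max_level nw) * quantum nw \<le> e"
  shows "charge nw l e = max_level nw"
proof -
  have "real (max_level nw) \<le> e / quantum nw"
    using assms quantum_pos[OF assms(1)] by (simp add: field_simps)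
  then have "int (max_level nw) \<le> \<lfloor>e / quantum nw\<rfloor>"
    by (simp add: le_floor_iff)
  then show ?thesis by (simp add: charge_def nat_le_iff min_def)
qed

text \<open>If every harvest stays below one quantum, only the transmitting source changes its level.\<close>

lemma transmission_step:
  fixes nw :: "('b::finite, 'k::finite) network"
  assumes valid: "valid_network nw" and l: "l \<in> transmission_states nw"
  obtains i where "i \<in> able_sources nw l"
    "measure (slot_law nw) {h \<in> space (slot_law nw). next_state nw l h = l(i := l i - tx_levels nw)} > 0"
proof -
  interpret S: prob_space "slot_law nw" by (rule prob_space_slot_law[OF valid])
  \<comment> \<open>When all squared gains in question are at most \<open>d\<close>, a busy harvest
    is at most \<open>c * d\<close>, and \<open>d\<close> makes this half a quantum.\<close>
  define c where "c = efficiency nw * slot_length nw * (source_power nw + beacon_power nw * (real CARD('b))\<^sup>2)"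
  define d where "d = quantum nw / (2 * c)"
  have pos: "efficiency nw > 0" "slot_length nw > 0" "beacon_power nw > 0"
    using valid by (auto simp: valid_network_def)
  have c: "c > 0"
    using pos source_power_pos[OF valid] by (simp add: c_def add_pos_nonneg)
  have d: "d > 0" using c quantum_pos[OF valid] by (simp add: d_def)
  \<comment> \<open>The box restricts only the channels into the sources. The \<open>BD\<close>
    links stay free because only the unit norm of the null beam enters the bound; the
    \<open>SD\<close> links stay free, so the transmitter is not prescribed.\<close>
  define A where "A = (\<lambda>e :: ('b, 'k) link. case e of
      BS b k \<Rightarrow> {z. (cmod z)\<^sup>2 < d} | SS i k \<Rightarrow> {z. (cmod z)\<^sup>2 < d} | _ \<Rightarrow> UNIV)"
  have Am: "A e \<in> sets borel" for e by (cases e) (auto simp: A_def)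
  have "measure (complex_gaussian (mean_gain nw e)) (A e) > 0" if "e \<in> links" for e
  proof -
    interpret G: prob_space "complex_gaussian (mean_gain nw e)"
      using mean_gain_pos[OF valid that] by (rule prob_space_complex_gaussian)
    have "measure (complex_gaussian (mean_gain nw e)) {z. (cmod z)\<^sup>2 < d} > 0"
      using mean_gain_pos[OF valid that] d by (simp add: measure_complex_gaussian_disc)
    then show ?thesis
      using G.prob_space by (cases e) (auto simp: A_def)
  qed
  then have box: "measure (slot_law nw) (PiE links A) > 0"
    by (simp add: measure_slot_law_box[OF valid] Am prod_pos)
  have able: "able_sources nw l \<noteq> {}" and lev: "l k \<le> max_level nw" for k
    using l by (auto simp: transmission_states_def energy_states_def)
  let ?E = "\<lambda>i. {h \<in> space (slot_law nw). next_state nw l h = l(i := l i - tx_levels nw)}"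
  \<comment> \<open>The box is covered by finitely many events, one per transmitter, so one of them
    has positive probability.\<close>
  have "PiE links A \<subseteq> (\<Union>i\<in>able_sources nw l. ?E i)"
  proof
    fix h assume h: "h \<in> PiE links A"
    have hs: "h \<in> space (slot_law nw)"
      using h by (auto simp: space_slot_law)
    define i where "i = selected nw l h"
    have "charge nw (l k) (busy_harvest nw h i k) = l k" if "k \<noteq> i" for k
    proof (rule charge_less_quantum[OF valid lev])
      have SS: "(cmod (h (SS i k)))\<^sup>2 \<le> d"
        using PiE_mem[OF h, of "SS i k"] that by (simp add: A_def)
      have "(cmod (vec_BS h k $ b))\<^sup>2 \<le> d" for b
        using PiE_mem[OF h, of "BS b k"] by (simp add: A_def vec_BS_def)
      moreover have "norm (null_beam nw (vec_BD h)) = 1"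
        using valid by (simp add: valid_network_def)
      ultimately have "(cmod (tprod (vec_BS h k) (null_beam nw (vec_BD h))))\<^sup>2 \<le> (real CARD('b))\<^sup>2 * d"
        by (rule tprod_bound)
      then have "busy_harvest nw h i k \<le> efficiency nw * slot_length nw *
          (source_power nw * d + beacon_power nw * ((real CARD('b))\<^sup>2 * d))"
        unfolding busy_harvest_def using pos source_power_pos[OF valid] SS
        by (intro mult_left_mono add_mono) auto
      also have "\<dots> = c * d" by (simp add: c_def algebra_simps)
      also have "\<dots> < quantum nw" using c quantum_pos[OF valid] by (simp add: d_def)
      finally show "busy_harvest nw h i k < quantum nw" .
      show "0 \<le> busy_harvest nw h i k"
        using pos source_power_pos[OF valid] by (simp add: busy_harvest_def)
    qed
    then have "next_state nw l h = l(i := l i - tx_levels nw)"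
      using able by (auto simp: next_state_def Let_def i_def fun_eq_iff)
    then show "h \<in> (\<Union>i\<in>able_sources nw l. ?E i)"
      using hs selected_able[OF able, of h] by (auto simp: i_def)
  qed
  then have "0 < measure (slot_law nw) (\<Union>i\<in>able_sources nw l. ?E i)"
    using next_state_event[OF valid]
    by (intro less_le_trans[OF box] S.finite_measure_mono) auto
  also have "\<dots> \<le> (\<Sum>i\<in>able_sources nw l. measure (slot_law nw) (?E i))"
    using next_state_event[OF valid] by (intro S.finite_measure_subadditive_finite) auto
  finally have "\<not> (\<forall>i\<in>able_sources nw l. measure (slot_law nw) (?E i) \<le> 0)"
    by (meson leD sum_nonpos)
  then show thesis using that by (auto simp: not_le)
qed

text \<open>If one antenna has a very strong channel to every source and the others have weak ones,
  no cancellation in the sum can prevent a harvest that fills every storage in one slot.\<close>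

lemma idle_step:
  fixes nw :: "('b::finite, 'k::finite) network"
  assumes valid: "valid_network nw" and l: "able_sources nw l = {}"
  shows "measure (slot_law nw) {h \<in> space (slot_law nw). next_state nw l h = (\<lambda>_. max_level nw)} > 0"
proof -
  interpret S: prob_space "slot_law nw" by (rule prob_space_slot_law[OF valid])
  define n where "n = real CARD('b)"
  define c where "c = efficiency nw * slot_length nw * beacon_power nw"
  have c: "c > 0"
    using valid by (auto simp: valid_network_def c_def)
  \<comment> \<open>\<open>T\<close> is the effective channel modulus at which the harvest equals a
    full storage.\<close>
  define T where "T = sqrt (real (max_level nw) * quantum nw / c)"
  have T: "T \<ge> 0" "c * T\<^sup>2 = real (max_level nw) * quantum nw"
    using c quantum_pos[OF valid] by (auto simp: T_def)
  \<comment> \<open>The weak antennas take at most \<open>n\<close> from the modulus of the sum, and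
    the uniform beam divides by \<open>sqrt n\<close>; a strong coefficient of modulus at least
    \<open>R\<close> thus leaves at least \<open>T\<close>.\<close>
  define R where "R = n + sqrt n * T"
  have n: "n > 0" by (simp add: n_def)
  have R: "R \<ge> 0" using n T by (simp add: R_def)
  fix b0 :: 'b
  define A where "A = (\<lambda>e :: ('b, 'k) link. case e of
      BS b k \<Rightarrow> if b = b0 then {z. R\<^sup>2 \<le> (cmod z)\<^sup>2} else {z. (cmod z)\<^sup>2 < 1} | _ \<Rightarrow> UNIV)"
  have Am: "A e \<in> sets borel" for e by (cases e) (auto simp: A_def)
  have "measure (complex_gaussian (mean_gain nw e)) (A e) > 0" if "e \<in> links" for e
  proof -
    interpret G: prob_space "complex_gaussian (mean_gain nw e)"
      using mean_gain_pos[OF valid that] by (rule prob_space_complex_gaussian)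
    have "measure (complex_gaussian (mean_gain nw e)) {z. (cmod z)\<^sup>2 < 1} > 0"
      "measure (complex_gaussian (mean_gain nw e)) {z. R\<^sup>2 \<le> (cmod z)\<^sup>2} > 0"
      using mean_gain_pos[OF valid that]
      by (simp_all only: measure_complex_gaussian_disc measure_complex_gaussian_tail zero_le_power2) simp_all
    then show ?thesis
      using G.prob_space by (cases e) (auto simp: A_def)
  qed
  then have box: "measure (slot_law nw) (PiE links A) > 0"
    by (simp add: measure_slot_law_box[OF valid] Am prod_pos)
  have "PiE links A \<subseteq> {h \<in> space (slot_law nw). next_state nw l h = (\<lambda>_. max_level nw)}"
  proof
    fix h assume h: "h \<in> PiE links A"
    have "charge nw (l k) (idle_harvest nw h k) = max_level nw" for k
    proof (rule charge_full[OF valid])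
      let ?S = "\<Sum>b\<in>UNIV. h (BS b k)"
      have b0: "R \<le> cmod (h (BS b0 k))"
        using PiE_mem[OF h, of "BS b0 k"] R by (simp add: A_def power2_le_iff_abs_le)
      have "cmod (h (BS b k)) \<le> 1" if "b \<noteq> b0" for b
        using PiE_mem[OF h, of "BS b k"] that by (simp add: A_def power_less_one_iff)
      then have "cmod (\<Sum>b\<in>UNIV - {b0}. h (BS b k)) \<le> (\<Sum>b\<in>UNIV - {b0}. 1)"
        by (intro order.trans[OF norm_sum] sum_mono) auto
      also have "\<dots> \<le> n" by (simp add: n_def)
      finally have rest: "cmod (\<Sum>b\<in>UNIV - {b0}. h (BS b k)) \<le> n" .
      have "?S = h (BS b0 k) + (\<Sum>b\<in>UNIV - {b0}. h (BS b k))"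
        by (rule sum.remove) auto
      then have "cmod (h (BS b0 k)) - cmod (\<Sum>b\<in>UNIV - {b0}. h (BS b k)) \<le> cmod ?S"
        by (simp add: norm_diff_ineq)
      then have "sqrt n * T \<le> cmod ?S" using b0 rest by (simp add: R_def)
      then have "T \<le> cmod ?S / sqrt n" using n by (simp add: field_simps)
      also have "\<dots> = cmod (tprod (vec_BS h k) uniform_beam)"
        by (simp add: tprod_def vec_BS_def uniform_beam_def n_def norm_divide flip: sum_divide_distrib)
      finally have "T\<^sup>2 \<le> (cmod (tprod (vec_BS h k) uniform_beam))\<^sup>2"
        using T by (intro power_mono) auto
      then have "c * T\<^sup>2 \<le> idle_harvest nw h k"
        unfolding idle_harvest_def c_def[symmetric] using c by simp
      then show "real (max_level nw) * quantum nw \<le> idle_harvest nw h k" by (simp add: T)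
    qed
    then show "h \<in> {h \<in> space (slot_law nw). next_state nw l h = (\<lambda>_. max_level nw)}"
      using h l by (auto simp: space_slot_law next_state_def)
  qed
  then show ?thesis
    using next_state_event[OF valid] by (intro less_le_trans[OF box] S.finite_measure_mono)
qed

section \<open>Independence of the state and the future channels\<close>

lemma (in prob_space) indep_vars_reindex:
  assumes inj: "inj_on f I" and ind: "indep_vars M' X (f ` I)"
  shows "indep_vars (\<lambda>i. M' (f i)) (\<lambda>i. X (f i)) I"
  unfolding indep_vars_def2 indep_sets_def
proof (intro conjI ballI allI impI)
  fix i assume "i \<in> I"
  then show "random_variable (M' (f i)) (X (f i))"
    "{X (f i) -` A \<inter> space M |A. A \<in> sets (M' (f i))} \<subseteq> events"
    using ind by (auto simp: indep_vars_def2 intro: measurable_sets)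
next
  fix J A assume J: "J \<subseteq> I" "J \<noteq> {}" "finite J"
    and A: "A \<in> (\<Pi> j\<in>J. {X (f j) -` B \<inter> space M |B. B \<in> sets (M' (f j))})"
  define A' where "A' = (\<lambda>j. A (inv_into J f j))"
  have injJ: "inj_on f J" using inj J(1) by (rule inj_on_subset)
  then have A': "A' (f j) = A j" if "j \<in> J" for j
    using that by (simp add: A'_def)
  have "prob (\<Inter>j\<in>f ` J. A' j) = (\<Prod>j\<in>f ` J. prob (A' j))"
  proof (rule indep_setsD)
    show "indep_sets (\<lambda>i. {X i -` A \<inter> space M |A. A \<in> sets (M' i)}) (f ` I)"
      using ind by (simp add: indep_vars_def2)
    show "\<forall>j\<in>f ` J. A' j \<in> {X j -` A \<inter> space M |A. A \<in> sets (M' j)}"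
      using A by (auto simp: A' Pi_iff)
  qed (use J in auto)
  then show "prob (\<Inter>j\<in>J. A j) = (\<Prod>j\<in>J. prob (A j))"
    using A' injJ by (simp add: prod.reindex)
qed

text \<open>The update uses \<open>SS i k\<close> only for \<open>k \<noteq> i\<close>, so values
  off \<open>links\<close> have no influence. A slot may therefore be treated as a point of the
  product space of \<open>slot_law\<close>.\<close>

lemma next_state_restrict: "next_state nw l (restrict h links) = next_state nw l h"
proof -
  have sel: "selected nw l (restrict h links) = selected nw l h"
    by (simp add: selected_def)
  have BS: "vec_BS (restrict h links) k = vec_BS h k" for k
    by (simp add: vec_BS_def)
  have BD: "vec_BD (restrict h links) = vec_BD h"
    by (simp add: vec_BD_def)
  have "idle_harvest nw (restrict h links) k = idle_harvest nw h k" for k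
    by (simp add: idle_harvest_def BS)
  moreover have "busy_harvest nw (restrict h links) i k = busy_harvest nw h i k" if "k \<noteq> i" for i k
    using that by (simp add: busy_harvest_def BS BD)
  ultimately show ?thesis
    by (auto simp: next_state_def sel Let_def fun_eq_iff)
qed

lemma snr_restrict: "snr nw l (restrict h links) = snr nw l h"
  by (simp add: snr_def selected_def)

lemma next_state_in_energy_states:
  assumes "l \<in> energy_states nw"
  shows "next_state nw l h \<in> energy_states nw"
proof -
  have "l k - tx_levels nw \<le> max_level nw" for k
    using assms by (simp add: energy_states_def diff_le_self[THEN order.trans])
  then show ?thesis
    by (auto simp: energy_states_def next_state_def Let_def charge_def)
qed

lemma finite_energy_states:
  fixes nw :: "('b::finite, 'k::finite) network"
  shows "finite (energy_states nw)"
proof -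
  have "energy_states nw = PiE UNIV (\<lambda>_. {..max_level nw})"
    by (auto simp: energy_states_def PiE_def)
  then show ?thesis by (simp add: finite_PiE)
qed

context network_process
begin

text \<open>Slot \<open>t\<close> itself is included, since \<open>X t\<close> is the state before
  the channels of that slot act. Restriction makes the value a point of
  \<open>future_space t\<close>.\<close>

definition future :: "nat \<Rightarrow> 'w \<Rightarrow> nat \<times> ('b, 'k) link \<Rightarrow> complex" where
  "future t \<omega> = (\<lambda>te\<in>{t..} \<times> links. H (fst te) (snd te) \<omega>)"

abbreviation future_space :: "nat \<Rightarrow> (nat \<times> ('b, 'k) link \<Rightarrow> complex) measure" where
  "future_space t \<equiv> (\<Pi>\<^sub>M te\<in>{t..} \<times> links. borel)"

definition slot :: "nat \<Rightarrow> 'w \<Rightarrow> ('b, 'k) link \<Rightarrow> complex" where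
  "slot t \<omega> = (\<lambda>e\<in>links. H t e \<omega>)"

definition current :: "nat \<Rightarrow> (nat \<times> ('b, 'k) link \<Rightarrow> complex) \<Rightarrow> ('b, 'k) link \<Rightarrow> complex" where
  "current t g = (\<lambda>e\<in>links. g (t, e))"

lemma channel_indep': "indep_vars (\<lambda>_. borel) (\<lambda>te. H (fst te) (snd te)) (UNIV \<times> links)"
  using channel_indep by (simp add: case_prod_beta')

lemma channel_measurable: "e \<in> links \<Longrightarrow> H t e \<in> borel_measurable M"
  using channel_indep' by (force simp: indep_vars_def)

lemma slot_measurable: "slot t \<in> measurable M (slot_law nw)"
  unfolding slot_def[abs_def] measurable_cong_sets[OF refl sets_slot_law]
  by (intro measurable_restrict channel_measurable)

lemma future_measurable: "future t \<in> measurable M (future_space t)"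
  unfolding future_def[abs_def] by (intro measurable_restrict channel_measurable) auto

lemma current_measurable:
  assumes "{t} \<times> links \<subseteq> I"
  shows "current t \<in> measurable (\<Pi>\<^sub>M te\<in>I. borel) (slot_law nw)"
  unfolding current_def[abs_def] measurable_cong_sets[OF refl sets_slot_law]
  using assms by (intro measurable_restrict measurable_component_singleton) auto

lemma current_future: "current t (future t \<omega>) = slot t \<omega>"
  by (auto simp: current_def future_def slot_def)

text \<open>The joint law of independent coefficients is the product of their marginals, which are
  the same in all slots.\<close>

lemma distr_slot: "distr M (slot_law nw) (slot t) = slot_law nw"
proof -
  have "indep_vars (\<lambda>_. borel) (\<lambda>te. H (fst te) (snd te)) (Pair t ` links)"
    using channel_indep' by (rule indep_vars_subset) auto
  then have "indep_vars (\<lambda>_. borel) (\<lambda>e. H (fst (t, e)) (snd (t, e))) links"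
    by (rule indep_vars_reindex[rotated]) (auto intro: inj_onI)
  then have "indep_vars (\<lambda>_. borel) (H t) links" by simp
  moreover have "SD undefined \<in> (links :: ('b, 'k) link set)" by simp
  then have "(links :: ('b, 'k) link set) \<noteq> {}" by blast
  ultimately have "distr M (\<Pi>\<^sub>M e\<in>links. borel) (slot t) = (\<Pi>\<^sub>M e\<in>links. distr M borel (H t e))"
    unfolding slot_def[abs_def]
    by (subst (asm) indep_vars_iff_distr_eq_PiM') (auto intro: channel_measurable)
  also have "\<dots> = slot_law nw"
    unfolding slot_law_def by (intro PiM_cong) (simp_all add: channel_law)
  finally show ?thesis
    using distr_cong[OF refl sets_slot_law[of nw], of M "slot t" "slot t"] by simp
qed

lemma prob_slot:
  assumes "C \<in> sets (slot_law nw)"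
  shows "prob {\<omega> \<in> space M. slot t \<omega> \<in> C} = measure (slot_law nw) C"
proof -
  have "measure (slot_law nw) C = measure (distr M (slot_law nw) (slot t)) C"
    by (simp add: distr_slot)
  also have "\<dots> = prob {\<omega> \<in> space M. slot t \<omega> \<in> C}"
    by (subst measure_distr[OF slot_measurable assms]) (auto intro!: arg_cong[where f = prob])
  finally show ?thesis by simp
qed

text \<open>Slot \<open>t\<close> and the later slots are disjoint index blocks of one independent
  family.\<close>

lemma slot_indep_future:
  assumes C: "C \<in> sets (slot_law nw)" and B: "B \<in> sets (future_space (Suc t))"
  shows "prob {\<omega> \<in> space M. slot t \<omega> \<in> C \<and> future (Suc t) \<omega> \<in> B} =
    measure (slot_law nw) C * prob {\<omega> \<in> space M. future (Suc t) \<omega> \<in> B}"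
proof -
  let ?X = "\<lambda>te. H (fst te) (snd te)"
  let ?now = "\<lambda>\<omega>. restrict (\<lambda>te. ?X te \<omega>) ({t} \<times> links)"
  let ?N = "\<Pi>\<^sub>M te\<in>{t} \<times> links. (borel :: complex measure)"
  let ?C = "current t -` C \<inter> space ?N"
  have "indep_var ?N ?now
      (future_space (Suc t)) (\<lambda>\<omega>. restrict (\<lambda>te. ?X te \<omega>) ({Suc t..} \<times> links))"
    by (rule indep_var_restrict[OF channel_indep']) auto
  then have "indep_var ?N ?now (future_space (Suc t)) (future (Suc t))"
    by (simp only: future_def[abs_def])
  then have "prob ((\<lambda>\<omega>. (?now \<omega>, future (Suc t) \<omega>)) -` (?C \<times> B) \<inter> space M) =
      prob (?now -` ?C \<inter> space M) * prob (future (Suc t) -` B \<inter> space M)"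
    by (rule indep_varD) (rule measurable_sets[OF current_measurable C], simp, rule B)
  moreover have "?now \<omega> \<in> ?C \<longleftrightarrow> slot t \<omega> \<in> C" for \<omega>
  proof -
    have "current t (?now \<omega>) = slot t \<omega>"
      by (auto simp: current_def slot_def)
    then show ?thesis by (simp add: space_PiM)
  qed
  then have "(\<lambda>\<omega>. (?now \<omega>, future (Suc t) \<omega>)) -` (?C \<times> B) \<inter> space M =
      {\<omega> \<in> space M. slot t \<omega> \<in> C \<and> future (Suc t) \<omega> \<in> B}"
    "?now -` ?C \<inter> space M = {\<omega> \<in> space M. slot t \<omega> \<in> C}"
    "future (Suc t) -` B \<inter> space M = {\<omega> \<in> space M. future (Suc t) \<omega> \<in> B}"
    by blast+
  ultimately show ?thesis by (simp only: prob_slot[OF C])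
qed

section \<open>Evolution of the state law and its independence of future channels\<close>

lemma dynamics_slot:
  "\<omega> \<in> space M \<Longrightarrow> X (Suc t) \<omega> = next_state nw (X t \<omega>) (slot t \<omega>)"
  using next_state_restrict[of nw "X t \<omega>" "\<lambda>e. H t e \<omega>"] by (simp add: dynamics slot_def)

lemma state_in_energy_states: "\<omega> \<in> space M \<Longrightarrow> X t \<omega> \<in> energy_states nw"
  by (induction t) (simp_all add: initial_state dynamics next_state_in_energy_states)

lemma state_measurable: "X t \<in> measurable M (count_space UNIV)"
proof (induction t)
  case 0
  show ?case by (rule initial_measurable)
next
  case (Suc t)
  have "(\<lambda>\<omega>. next_state nw (X t \<omega>) (slot t \<omega>)) \<in> measurable M (count_space UNIV)"
    by (rule measurable_compose_countable[OF _ Suc])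
       (rule measurable_compose[OF slot_measurable measurable_next_state[OF valid]])
  then show ?case
    by (subst measurable_cong[OF dynamics_slot])
qed

lemma state_event: "{\<omega> \<in> space M. X t \<omega> = l} \<in> events"
  using measurable_sets[OF state_measurable[of t], of "{l}"]
  by (simp add: vimage_def Collect_conj_eq Int_commute)

lemma future_event: "B \<in> sets (future_space t) \<Longrightarrow> {\<omega> \<in> space M. future t \<omega> \<in> B} \<in> events"
  using measurable_sets[OF future_measurable[of t], of B]
  by (simp add: vimage_def Collect_conj_eq Int_commute)

lemma state_future_event:
  "B \<in> sets (future_space t) \<Longrightarrow> {\<omega> \<in> space M. X t \<omega> = l \<and> future t \<omega> \<in> B} \<in> events"
  using sets.Int[OF state_event[of t l] future_event[of B t]]
  by (simp add: Collect_conj_eq Int_ac)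

text \<open>Once \<open>X t\<close> is fixed, the next state depends only on slot \<open>t\<close>.
  Independence at time \<open>t\<close> splits off the state, and then slot \<open>t\<close> splits
  from the later slots. Independence at time \<open>t\<close> is a hypothesis so that an induction
  can supply it.\<close>

lemma prob_state_future_Suc:
  assumes indep: "\<And>l B. B \<in> sets (future_space t) \<Longrightarrow>
      prob {\<omega> \<in> space M. X t \<omega> = l \<and> future t \<omega> \<in> B} =
      prob {\<omega> \<in> space M. X t \<omega> = l} * prob {\<omega> \<in> space M. future t \<omega> \<in> B}"
    and B: "B \<in> sets (future_space (Suc t))"
  shows "prob {\<omega> \<in> space M. X (Suc t) \<omega> = l' \<and> future (Suc t) \<omega> \<in> B} =
    (\<Sum>l\<in>energy_states nw. prob {\<omega> \<in> space M. X t \<omega> = l} *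
       measure (slot_law nw) {h \<in> space (slot_law nw). next_state nw l h = l'}) *
    prob {\<omega> \<in> space M. future (Suc t) \<omega> \<in> B}"
proof -
  let ?C = "\<lambda>l. {h \<in> space (slot_law nw). next_state nw l h = l'}"
  let ?r = "\<lambda>g. restrict g ({Suc t..} \<times> links)"
  have sub: "{Suc t..} \<times> links \<subseteq> {t..} \<times> (links :: ('b, 'k) link set)" by auto
  have cur: "current t \<in> measurable (future_space t) (slot_law nw)"
    by (rule current_measurable) auto
  have res: "?r \<in> measurable (future_space t) (future_space (Suc t))"
    by (rule measurable_restrict_subset[OF sub])
  have fut: "?r (future t \<omega>) = future (Suc t) \<omega>" for \<omega>
    by (auto simp: future_def fun_eq_iff)
  \<comment> \<open>\<open>D l\<close> collects the futures whose first slot moves \<open>l\<close>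
    to \<open>l'\<close> and whose later slots lie in \<open>B\<close>.\<close>
  define D where "D = (\<lambda>l. (current t -` ?C l \<inter> space (future_space t)) \<inter>
      (?r -` B \<inter> space (future_space t)))"
  have D: "D l \<in> sets (future_space t)" for l
    unfolding D_def
    by (intro sets.Int measurable_sets[OF cur] measurable_sets[OF res] B next_state_event[OF valid])
  have mem: "future t \<omega> \<in> D l \<longleftrightarrow> slot t \<omega> \<in> ?C l \<and> future (Suc t) \<omega> \<in> B"
    if "\<omega> \<in> space M" for \<omega> l
    using measurable_space[OF future_measurable that, of t] fut[of \<omega>]
    by (auto simp: D_def current_future)
  have slot_space: "slot t \<omega> \<in> space (slot_law nw)" if "\<omega> \<in> space M" for \<omega>
    using measurable_space[OF slot_measurable that] .
  have "{\<omega> \<in> space M. X (Suc t) \<omega> = l' \<and> future (Suc t) \<omega> \<in> B} =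
      (\<Union>l\<in>energy_states nw. {\<omega> \<in> space M. X t \<omega> = l \<and> future t \<omega> \<in> D l})"
    using state_in_energy_states slot_space by (auto simp: mem dynamics_slot)
  also have "prob \<dots> = (\<Sum>l\<in>energy_states nw. prob {\<omega> \<in> space M. X t \<omega> = l \<and> future t \<omega> \<in> D l})"
    by (intro finite_measure_finite_Union finite_energy_states)
       (auto intro: state_future_event[OF D] simp: disjoint_family_on_def)
  also have "\<dots> = (\<Sum>l\<in>energy_states nw. prob {\<omega> \<in> space M. X t \<omega> = l} *
      (measure (slot_law nw) (?C l) * prob {\<omega> \<in> space M. future (Suc t) \<omega> \<in> B}))"
  proof (rule sum.cong[OF refl])
    fix l
    have "{\<omega> \<in> space M. future t \<omega> \<in> D l} = {\<omega> \<in> space M. slot t \<omega> \<in> ?C l \<and> future (Suc t) \<omega> \<in> B}"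
      using mem by auto
    then show "prob {\<omega> \<in> space M. X t \<omega> = l \<and> future t \<omega> \<in> D l} = prob {\<omega> \<in> space M. X t \<omega> = l} *
      (measure (slot_law nw) (?C l) * prob {\<omega> \<in> space M. future (Suc t) \<omega> \<in> B})"
      by (simp only: indep[OF D] slot_indep_future[OF next_state_event[OF valid] B])
  qed
  finally show ?thesis by (simp add: sum_distrib_right mult.assoc)
qed

lemma prob_future_space: "prob {\<omega> \<in> space M. future t \<omega> \<in> space (future_space t)} = 1"
proof -
  have "{\<omega> \<in> space M. future t \<omega> \<in> space (future_space t)} = space M"
    using measurable_space[OF future_measurable] by auto
  then show ?thesis by (simp only: prob_space)
qed

text \<open>Taking the whole space for \<open>B\<close> leaves the one-step recursion of the
  chain.\<close>

lemma state_Suc_law: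
  assumes indep: "\<And>l B. B \<in> sets (future_space t) \<Longrightarrow>
      prob {\<omega> \<in> space M. X t \<omega> = l \<and> future t \<omega> \<in> B} =
      prob {\<omega> \<in> space M. X t \<omega> = l} * prob {\<omega> \<in> space M. future t \<omega> \<in> B}"
  shows "prob {\<omega> \<in> space M. X (Suc t) \<omega> = l'} =
    (\<Sum>l\<in>energy_states nw. prob {\<omega> \<in> space M. X t \<omega> = l} *
       measure (slot_law nw) {h \<in> space (slot_law nw). next_state nw l h = l'})"
proof -
  have "{\<omega> \<in> space M. X (Suc t) \<omega> = l'} =
      {\<omega> \<in> space M. X (Suc t) \<omega> = l' \<and> future (Suc t) \<omega> \<in> space (future_space (Suc t))}"
    using measurable_space[OF future_measurable] by auto
  then show ?thesis
    using prob_state_future_Suc[OF indep sets.top, of l'] prob_future_space[of "Suc t"] by simp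
qed

lemma state_indep_future:
  "B \<in> sets (future_space t) \<Longrightarrow>
    prob {\<omega> \<in> space M. X t \<omega> = l \<and> future t \<omega> \<in> B} =
    prob {\<omega> \<in> space M. X t \<omega> = l} * prob {\<omega> \<in> space M. future t \<omega> \<in> B}"
proof (induction t arbitrary: l B)
  case 0
  \<comment> \<open>From slot 0 on, the future consists of all channels, so the base case is
    \<open>initial_indep\<close>.\<close>
  have all: "{0..} = (UNIV :: nat set)" by auto
  have fut: "future 0 = (\<lambda>\<omega>. \<lambda>(t, e)\<in>UNIV \<times> links. H t e \<omega>)"
    by (auto simp: future_def fun_eq_iff)
  have "prob ((X 0 -` {l} \<inter> space M) \<inter> (future 0 -` B \<inter> space M)) =
      prob (X 0 -` {l} \<inter> space M) * prob (future 0 -` B \<inter> space M)"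
    by (rule indep_setD[OF initial_indep])
       (use 0 in \<open>auto simp: fut all intro!: in_vimage_algebra\<close>)
  moreover have "X 0 -` {l} \<inter> space M = {\<omega> \<in> space M. X 0 \<omega> = l}"
    "future 0 -` B \<inter> space M = {\<omega> \<in> space M. future 0 \<omega> \<in> B}"
    "{\<omega> \<in> space M. X 0 \<omega> = l} \<inter> {\<omega> \<in> space M. future 0 \<omega> \<in> B} =
      {\<omega> \<in> space M. X 0 \<omega> = l \<and> future 0 \<omega> \<in> B}"
    by auto
  ultimately show ?case by simp
next
  case (Suc t)
  \<comment> \<open>The sum multiplying the future probability is the law of
    \<open>X (Suc t)\<close>.\<close>
  show ?case
    using prob_state_future_Suc[OF Suc.IH Suc.prems, of l] state_Suc_law[OF Suc.IH, of l] by simp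
qed

lemma prob_state_slot:
  assumes C: "C \<in> sets (slot_law nw)"
  shows "prob {\<omega> \<in> space M. X t \<omega> = l \<and> slot t \<omega> \<in> C} =
    prob {\<omega> \<in> space M. X t \<omega> = l} * measure (slot_law nw) C"
proof -
  have cur: "current t \<in> measurable (future_space t) (slot_law nw)"
    by (rule current_measurable) auto
  let ?B = "current t -` C \<inter> space (future_space t)"
  have "future t \<omega> \<in> ?B \<longleftrightarrow> slot t \<omega> \<in> C" if "\<omega> \<in> space M" for \<omega>
    using measurable_space[OF future_measurable that, of t] by (simp add: current_future)
  then have "{\<omega> \<in> space M. X t \<omega> = l \<and> future t \<omega> \<in> ?B} = {\<omega> \<in> space M. X t \<omega> = l \<and> slot t \<omega> \<in> C}"
    "{\<omega> \<in> space M. future t \<omega> \<in> ?B} = {\<omega> \<in> space M. slot t \<omega> \<in> C}"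
    by blast+
  then show ?thesis
    using state_indep_future[OF measurable_sets[OF cur C], of l] by (simp only: prob_slot[OF C])
qed

text \<open>Reindexed along \<open>s\<close>, the one-step recursion is multiplication by the
  transition matrix, which fixes the initial law.\<close>

lemma state_law_stationary:
  fixes s :: "'n::finite \<Rightarrow> 'k \<Rightarrow> nat"
  assumes s: "bij_betw s UNIV (energy_states nw)"
    and p: "stationary_distribution (transition_matrix nw s) (state_law M s (X 0))"
  shows "state_law M s (X t) = state_law M s (X 0)"
proof (induction t)
  case (Suc t)
  have "state_law M s (X (Suc t)) $ n' = (state_law M s (X t) v* transition_matrix nw s) $ n'" for n'
    using state_Suc_law[OF state_indep_future, of t "s n'"]
    by (simp add: state_law_def transition_matrix_def vector_matrix_mult_def
        sum.reindex_bij_betw[OF s, symmetric] mult.commute)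
  then have "state_law M s (X (Suc t)) = state_law M s (X t) v* transition_matrix nw s"
    by (simp add: vec_eq_iff)
  then show ?case
    using Suc p by (simp add: stationary_distribution_def)
qed simp

end

section \<open>Outage probability\<close>

lemma outage_slot:
  fixes nw :: "('b::finite, 'k::finite) network"
  assumes valid: "valid_network nw" and l: "able_sources nw l \<noteq> {}"
  shows "{h \<in> space (slot_law nw). snr nw l h < snr_threshold nw} \<in> sets (slot_law nw)"
    and "measure (slot_law nw) {h \<in> space (slot_law nw). snr nw l h < snr_threshold nw} =
      (\<Prod>k\<in>able_sources nw l.
         1 - exp (- (noise_power nw * snr_threshold nw / (mean_SD nw k * source_power nw))))"
proof -
  \<comment> \<open>\<open>x\<close> is the squared gain at which the signal-to-noise ratio meets
    the threshold.\<close>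
  define x where "x = noise_power nw * snr_threshold nw / source_power nw"
  have pos: "noise_power nw > 0" "source_power nw > 0" "snr_threshold nw > 0"
    using valid source_power_pos[OF valid]
    by (auto simp: valid_network_def snr_threshold_def)
  have x: "x \<ge> 0" using pos by (simp add: x_def)
  define A where "A = (\<lambda>e :: ('b, 'k) link. case e of
    SD k \<Rightarrow> if k \<in> able_sources nw l then {z. (cmod z)\<^sup>2 < x} else UNIV | _ \<Rightarrow> UNIV)"
  have Am: "A e \<in> sets borel" for e by (cases e) (auto simp: A_def)
  have snr: "snr nw l h < snr_threshold nw \<longleftrightarrow>
      (\<forall>k\<in>able_sources nw l. (cmod (h (SD k)))\<^sup>2 < x)" for h
  proof -
    have "snr nw l h < snr_threshold nw \<longleftrightarrow> (cmod (h (SD (selected nw l h))))\<^sup>2 < x"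
      using pos by (simp add: snr_def x_def field_simps)
    also have "\<dots> \<longleftrightarrow> (\<forall>k\<in>able_sources nw l. (cmod (h (SD k)))\<^sup>2 < x)"
      using selected_able[OF l] selected_max[OF l] by (meson le_less_trans)
    finally show ?thesis .
  qed
  have set_eq: "{h \<in> space (slot_law nw). snr nw l h < snr_threshold nw} = PiE links A"
  proof (intro set_eqI iffI)
    fix h assume h: "h \<in> {h \<in> space (slot_law nw). snr nw l h < snr_threshold nw}"
    then have "h e \<in> A e" for e
      by (cases e) (auto simp: snr A_def)
    then show "h \<in> PiE links A" using h by (auto simp: space_slot_law)
  next
    fix h assume h: "h \<in> PiE links A"
    have "(cmod (h (SD k)))\<^sup>2 < x" if "k \<in> able_sources nw l" for k
      using PiE_mem[OF h, of "SD k"] that by (simp add: A_def)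
    then show "h \<in> {h \<in> space (slot_law nw). snr nw l h < snr_threshold nw}"
      using h by (auto simp: space_slot_law snr)
  qed
  show "{h \<in> space (slot_law nw). snr nw l h < snr_threshold nw} \<in> sets (slot_law nw)"
    unfolding set_eq sets_slot_law by (intro sets_PiM_I_finite finite_link Am)
  have "measure (slot_law nw) (PiE links A) = (\<Prod>e\<in>links. measure (complex_gaussian (mean_gain nw e)) (A e))"
    by (rule measure_slot_law_box[OF valid Am])
  \<comment> \<open>All other links are unconstrained and contribute the factor 1.\<close>
  also have "\<dots> = (\<Prod>e\<in>SD ` able_sources nw l. measure (complex_gaussian (mean_gain nw e)) (A e))"
  proof (rule prod.mono_neutral_right)
    show "\<forall>e\<in>links - SD ` able_sources nw l. measure (complex_gaussian (mean_gain nw e)) (A e) = 1"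
    proof
      fix e :: "('b, 'k) link" assume e: "e \<in> links - SD ` able_sources nw l"
      then interpret G: prob_space "complex_gaussian (mean_gain nw e)"
        using mean_gain_pos[OF valid] by (intro prob_space_complex_gaussian) auto
      have "A e = UNIV" using e by (cases e) (auto simp: A_def)
      then show "measure (complex_gaussian (mean_gain nw e)) (A e) = 1"
        using G.prob_space by simp
    qed
  qed (auto simp: finite_link)
  also have "\<dots> = (\<Prod>k\<in>able_sources nw l. measure (complex_gaussian (mean_SD nw k)) {z. (cmod z)\<^sup>2 < x})"
    by (subst prod.reindex) (auto simp: A_def inj_on_def)
  also have "\<dots> = (\<Prod>k\<in>able_sources nw l.
      1 - exp (- (noise_power nw * snr_threshold nw / (mean_SD nw k * source_power nw))))"
    using valid x
    by (intro prod.cong refl) (subst measure_complex_gaussian_disc, auto simp: valid_network_def x_def mult.commute)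
  finally show "measure (slot_law nw) {h \<in> space (slot_law nw). snr nw l h < snr_threshold nw} = \<dots>"
    unfolding set_eq .
qed

section \<open>Row sums and closed sets of the transition matrix\<close>

lemma transition_matrix_row_sum:
  fixes nw :: "('b::finite, 'k::finite) network" and s :: "'n::finite \<Rightarrow> 'k \<Rightarrow> nat"
  assumes valid: "valid_network nw" and s: "bij_betw s UNIV (energy_states nw)"
  shows "(\<Sum>n'\<in>UNIV. transition_matrix nw s $ n $ n') = 1"
proof -
  interpret S: prob_space "slot_law nw" by (rule prob_space_slot_law[OF valid])
  let ?E = "\<lambda>n'. {h \<in> space (slot_law nw). next_state nw (s n) h = s n'}"
  have "s n \<in> energy_states nw" using s by (auto simp: bij_betw_def)
  then have "next_state nw (s n) h \<in> range s" for h
    using s next_state_in_energy_states by (auto simp: bij_betw_def)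
  \<comment> \<open>The chain never leaves the enumerated states, and injectivity of
    \<open>s\<close> makes the events below disjoint.\<close>
  then have "space (slot_law nw) = (\<Union>n'. ?E n')" by auto
  then have "1 = measure (slot_law nw) (\<Union>n'. ?E n')"
    using S.prob_space by simp
  also have "\<dots> = (\<Sum>n'\<in>UNIV. measure (slot_law nw) (?E n'))"
    using s by (intro S.finite_measure_finite_Union)
      (auto intro: next_state_event[OF valid] simp: disjoint_family_on_def bij_betw_def dest: injD)
  finally show ?thesis by (simp add: transition_matrix_def)
qed

text \<open>A state of least total energy in \<open>C\<close> cannot have an able source, since a
  transmission without recharging would lead to a state of \<open>C\<close> with less energy. From
  it an idle step reaches the full state.\<close>

lemma full_state_in_closed_set:
  fixes nw :: "('b::finite, 'k::finite) network" and s :: "'n::finite \<Rightarrow> 'k \<Rightarrow> nat"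
  assumes valid: "valid_network nw" and s: "bij_betw s UNIV (energy_states nw)"
    and r: "s r = (\<lambda>_. max_level nw)"
    and ne: "C \<noteq> {}"
    and closed: "\<And>i j. i \<in> C \<Longrightarrow> transition_matrix nw s $ i $ j > 0 \<Longrightarrow> j \<in> C"
  shows "r \<in> C"
proof -
  have es: "s n \<in> energy_states nw" for n using s by (auto simp: bij_betw_def)
  obtain n where n: "n \<in> C" and min: "\<And>m. m \<in> C \<Longrightarrow> (\<Sum>k\<in>UNIV. s n k) \<le> (\<Sum>k\<in>UNIV. s m k)"
    using ne ex_has_least_nat[of "\<lambda>n. n \<in> C" _ "\<lambda>n. \<Sum>k\<in>UNIV. s n k"] by blast
  have "able_sources nw (s n) = {}"
  proof (rule ccontr)
    assume "able_sources nw (s n) \<noteq> {}"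
    then have "s n \<in> transmission_states nw" using es by (simp add: transmission_states_def)
    then obtain i where i: "i \<in> able_sources nw (s n)"
      and P: "measure (slot_law nw) {h \<in> space (slot_law nw).
        next_state nw (s n) h = (s n)(i := s n i - tx_levels nw)} > 0"
      by (rule transmission_step[OF valid])
    let ?l = "(s n)(i := s n i - tx_levels nw)"
    have "?l \<in> energy_states nw"
      using es[of n] by (auto simp: energy_states_def intro: diff_le_self[THEN order.trans])
    then obtain m where m: "s m = ?l" using s by (metis bij_betw_def image_iff)
    then have "m \<in> C" using P by (intro closed[OF n]) (simp add: transition_matrix_def)
    then have "(\<Sum>k\<in>UNIV. s n k) \<le> (\<Sum>k\<in>UNIV. ?l k)" using min m by metis
    \<comment> \<open>The drop is strict because source \<open>i\<close> holds at least
      \<open>tx_levels nw\<close> levels, and this number is at least 1.\<close>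
    moreover have "(\<Sum>k\<in>UNIV. ?l k) < (\<Sum>k\<in>UNIV. s n k)"
      using i valid by (intro sum_strict_mono_ex1) (auto simp: able_sources_def valid_network_def intro!: exI[of _ i])
    ultimately show False by simp
  qed
  then show ?thesis
    using idle_step[OF valid] by (intro closed[OF n]) (simp add: transition_matrix_def r)
qed

section \<open>The outage formula for the stationary chain\<close>

theorem theorem2:
  fixes nw :: "('b::finite, 'k::finite) network"
    and s :: "'n::finite \<Rightarrow> 'k \<Rightarrow> nat"
    and M :: "'w measure"
    and H :: "nat \<Rightarrow> ('b, 'k) link \<Rightarrow> 'w \<Rightarrow> complex"
    and X :: "nat \<Rightarrow> 'w \<Rightarrow> 'k \<Rightarrow> nat"
    and t :: nat
  assumes enumeration: "bij_betw s UNIV (energy_states nw)"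
    and process: "network_process M nw H X"
    and stationary: "stationary_distribution (transition_matrix nw s) (state_law M s (X 0))"
  shows "let A = transition_matrix nw s;
             E = mat 1 :: real ^ 'n ^ 'n;
             Q = (\<chi> i j. 1) :: real ^ 'n ^ 'n;
             b = (\<chi> i. 1) :: real ^ 'n;
             p = matrix_inv (transpose A - E + Q) *v b
         in invertible (transpose A - E + Q) \<and>
            connection_outage_prob M nw H X t =
              (\<Sum>n | s n \<in> transmission_states nw.
                 p $ n * (\<Prod>k\<in>able_sources nw (s n).
                   1 - exp (- (noise_power nw * snr_threshold nw /
                               (mean_SD nw k * source_power nw)))))"
proof -
  interpret network_process M nw H X by (rule process)
  let ?A = "transition_matrix nw s"
  let ?q = "\<lambda>l. \<Prod>k\<in>able_sources nw l.
    1 - exp (- (noise_power nw * snr_threshold nw / (mean_SD nw k * source_power nw)))"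
  have "(\<lambda>_. max_level nw) \<in> energy_states nw" by (simp add: energy_states_def)
  then obtain r where r: "s r = (\<lambda>_. max_level nw)"
    using enumeration by (metis bij_betw_def image_iff)
  have inv: "invertible (transpose ?A - mat 1 + (\<chi> i j. 1))"
    by (rule invertible_stationary_matrix[where r = r,
          OF _ transition_matrix_row_sum[OF valid enumeration]
            full_state_in_closed_set[OF valid enumeration r] stationary])
       (simp_all add: transition_matrix_def)
  \<comment> \<open>The initial law solves the linear system and persists, so the solution is also
    the law of \<open>X t\<close> at the arbitrary slot \<open>t\<close>.\<close>
  have p: "matrix_inv (transpose ?A - mat 1 + (\<chi> i j. 1)) *v (\<chi> i. 1) = state_law M s (X t)"
    unfolding state_law_stationary[OF enumeration stationary, of t]
    by (rule stationary_eq_matrix_inv[OF inv stationary])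
  let ?C = "\<lambda>l. {h \<in> space (slot_law nw). snr nw l h < snr_threshold nw}"
  let ?T = "{n. s n \<in> transmission_states nw}"
  have C: "?C (s n) \<in> sets (slot_law nw)" "measure (slot_law nw) (?C (s n)) = ?q (s n)" if "n \<in> ?T" for n
    using that outage_slot[OF valid, of "s n"] by (auto simp: transmission_states_def)
  have slot_space: "slot t \<omega> \<in> space (slot_law nw)" if "\<omega> \<in> space M" for \<omega>
    using measurable_space[OF slot_measurable that] .
  have range: "l \<in> range s" if "l \<in> transmission_states nw" for l
    using that enumeration by (auto simp: transmission_states_def bij_betw_def)
  have "{\<omega> \<in> space M. X t \<omega> \<in> transmission_states nw \<and>
        snr nw (X t \<omega>) (\<lambda>e. H t e \<omega>) < snr_threshold nw} =
      {\<omega> \<in> space M. X t \<omega> \<in> transmission_states nw \<and> slot t \<omega> \<in> ?C (X t \<omega>)}"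
    using slot_space by (auto simp: slot_def snr_restrict)
  \<comment> \<open>Splitting by the current state freezes it in the outage event; independence of
    state and slot then factors each term.\<close>
  also have "\<dots> = (\<Union>n\<in>?T. {\<omega> \<in> space M. X t \<omega> = s n \<and> slot t \<omega> \<in> ?C (s n)})"
    using range by fastforce
  also have "prob \<dots> = (\<Sum>n\<in>?T. prob {\<omega> \<in> space M. X t \<omega> = s n \<and> slot t \<omega> \<in> ?C (s n)})"
  proof (rule finite_measure_finite_Union)
    have "{\<omega> \<in> space M. X t \<omega> = s n \<and> slot t \<omega> \<in> ?C (s n)} \<in> events" if "n \<in> ?T" for n
    proof -
      have "{\<omega> \<in> space M. X t \<omega> = s n \<and> slot t \<omega> \<in> ?C (s n)} =
          {\<omega> \<in> space M. X t \<omega> = s n} \<inter> (slot t -` ?C (s n) \<inter> space M)"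
        by auto
      also have "\<dots> \<in> events"
        using measurable_sets[OF slot_measurable C(1)[OF that]] state_event by blast
      finally show ?thesis .
    qed
    then show "(\<lambda>n. {\<omega> \<in> space M. X t \<omega> = s n \<and> slot t \<omega> \<in> ?C (s n)}) ` ?T \<subseteq> events" by blast
    show "disjoint_family_on (\<lambda>n. {\<omega> \<in> space M. X t \<omega> = s n \<and> slot t \<omega> \<in> ?C (s n)}) ?T"
      using enumeration by (auto simp: disjoint_family_on_def bij_betw_def dest: injD)
  qed simp
  also have "\<dots> = (\<Sum>n\<in>?T. state_law M s (X t) $ n * ?q (s n))"
    by (intro sum.cong refl) (simp only: prob_state_slot[OF C(1)] C(2) state_law_def vec_lambda_beta)
  finally show ?thesis
    unfolding Let_def p connection_outage_prob_def using inv by blast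
qed

end
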